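(* Let $\Lambda\subset\mathbb R^n$ be a model set arising from a Euclidean cut-and-project scheme $(\mathbb R^n,\mathbb R^n_{\mathrm{int}},\mathcal L)$ with window $W$, and let $\vartheta:\mathbb R^n_{\mathrm{int}}\to\mathbb R^n$ be a linear mapping, represented by the matrix $D$ with respect to the standard bases in $\mathbb R^n_{\mathrm{int}}$ and $\mathbb R^n$. Then, for $k\in L^\circledast$ (the Fourier module of the scheme), the Fourier–Bohr coefficients $A_{\Lambda_\vartheta}(k)$ of the deformed model set $\Lambda_\vartheta=\{x+\vartheta(x^\star): x\in\Lambda\}$ are given by $$A_{\Lambda_\vartheta}(k)=H(k^\star-D^{\top}k),$$ with $$H(k_{\mathrm{int}})=\frac{\operatorname{dens}(\Lambda)}{\operatorname{vol}(W)}\,\check{\mathbf 1}_W(k_{\mathrm{int}}),$$ where $\check{\mathbf 1}_W(k_{\mathrm{int}})=\int_W e^{2\pi i\langle k_{\mathrm{int}},y\rangle}\,\mathrm dy$ is the inverse Fourier transform of the characteristic function of $W$.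
   Context: A Euclidean cut-and-project scheme $(\mathbb R^n,\mathbb R^n_{\mathrm{int}},\mathcal L)$ consists of a lattice $\mathcal L\subset\mathbb R^n\times\mathbb R^n_{\mathrm{int}}$ (where $\mathbb R^n_{\mathrm{int}}$ is a copy of $\mathbb R^n$, called internal space) such that the canonical projection $\pi:\mathbb R^n\times\mathbb R^n_{\mathrm{int}}\to\mathbb R^n$ is injective on $\mathcal L$ and the image of $\mathcal L$ under the canonical projection $\pi_{\mathrm{int}}$ to $\mathbb R^n_{\mathrm{int}}$ is dense. With $L=\pi(\mathcal L)$, the star map $\star:L\to\mathbb R^n_{\mathrm{int}}$ is defined by $(x,x^\star)\in\mathcal L$ for $x\in L$. The model set with window $W$ is $\Lambda=\{x\in L: x^\star\in W\}$, where $W\subset\mathbb R^n_{\mathrm{int}}$ is relatively compact with non-empty interior. The dual lattice is $\mathcal L^*=\{z\in\mathbb R^n\times\mathbb R^n_{\mathrm{int}}:\langle z,w\rangle\in\mathbb Z\text{ for all }w\in\mathcal L\}$. The Fourier module is $L^\circledast=\pi(\mathcal L^* )$, and for $k\in L^\circledast$ the point $k^\star\in\mathbb R^n_{\mathrm{int}}$ is the one with $(k,k^\star)\in\mathcal L^*$. $\operatorname{dens}(\Lambda)$ is the point density of $\Lambda$ (the limit of the number of points of $\Lambda$ in $B_r(0)$ divided by $\operatorname{vol}(B_r(0))$ as $r\to\infty$), and $\operatorname{vol}(W)$ is the Lebesgue measure of $W$. For a point set $\Gamma\subset\mathbb R^n$ and $k\in\mathbb R^n$, the Fourier–Bohr coefficient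 is $A_\Gamma(k)=\lim_{r\to\infty}\frac1{\operatorname{vol}(B_r(0))}\sum_{x\in\Gamma,\ |x|\le r}e^{-2\pi i\langle k,x\rangle}$.
   Formalization: The window W is assumed to have a boundary of Lebesgue measure zero, and the formula is proved for the set Λ_ϑ when x ↦ x+ϑ(x* ) is injective on Λ, otherwise for its points counted with multiplicity; without these the claim fails. *)

theory Defs
  imports "HOL-Analysis.Analysis"
begin

definition is_lattice :: "'a::euclidean_space set \<Rightarrow> bool" where
  "is_lattice L \<longleftrightarrow>
     (\<exists>B. independent B \<and> span B = UNIV \<and>
          L = {\<Sum>b\<in>B. of_int (c b) *\<^sub>R b | c :: 'a \<Rightarrow> int. True})"

text \<open>The first factor is physical space, the second one is internal space.\<close>

definition euclidean_cps :: "((real ^ 'n) \<times> (real ^ 'n)) set \<Rightarrow> bool" where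
  "euclidean_cps L \<longleftrightarrow> is_lattice L \<and> inj_on fst L \<and> closure (snd ` L) = UNIV"

text \<open>
  \<open>star_map L x\<close> is meaningful whenever \<open>fst\<close> is injective on \<open>L\<close> and \<open>x \<in> fst ` L\<close>.
  It is used for the lattice of a cut-and-project scheme and also for its dual lattice, on which
  \<open>fst\<close> is injective because \<open>snd ` L\<close> is dense.
\<close>

definition star_map :: "((real ^ 'n) \<times> (real ^ 'n)) set \<Rightarrow> real ^ 'n \<Rightarrow> real ^ 'n" where
  "star_map L x = (THE y. (x, y) \<in> L)"

definition window :: "(real ^ 'n) set \<Rightarrow> bool" where
  "window W \<longleftrightarrow> compact (closure W) \<and> interior W \<noteq> {}"

definition model_set ::
    "((real ^ 'n) \<times> (real ^ 'n)) set \<Rightarrow> (real ^ 'n) set \<Rightarrow> (real ^ 'n) set" where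
  "model_set L W = {x \<in> fst ` L. star_map L x \<in> W}"

definition dual_lattice :: "'a::euclidean_space set \<Rightarrow> 'a set" where
  "dual_lattice L = {z. \<forall>w\<in>L. z \<bullet> w \<in> \<int>}"

definition fourier_module :: "((real ^ 'n) \<times> (real ^ 'n)) set \<Rightarrow> (real ^ 'n) set" where
  "fourier_module L = fst ` dual_lattice L"

definition dens :: "(real ^ 'n) set \<Rightarrow> real" where
  "dens \<Gamma> = Lim at_top
     (\<lambda>r. real (card (\<Gamma> \<inter> cball 0 r)) / measure lebesgue (cball (0 :: real ^ 'n) r))"

text \<open>
  The point family \<open>(p i)\<close>, \<open>i \<in> I\<close>, is counted with multiplicity: a point hit by several
  indices contributes once for each of them.  The Fourier--Bohr coefficient is a limit, so that
  a value is assigned by a relation which includes the existence of the limit.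
\<close>

definition has_fourier_bohr_coeff_family ::
    "('i \<Rightarrow> real ^ 'n) \<Rightarrow> 'i set \<Rightarrow> real ^ 'n \<Rightarrow> complex \<Rightarrow> bool" where
  "has_fourier_bohr_coeff_family p I k a \<longleftrightarrow>
     ((\<lambda>r. (\<Sum>i\<in>{i\<in>I. norm (p i) \<le> r}. cis (- (2 * pi * (k \<bullet> p i))))
            / of_real (measure lebesgue (cball (0 :: real ^ 'n) r))) \<longlongrightarrow> a) at_top"

definition has_fourier_bohr_coeff ::
    "(real ^ 'n) set \<Rightarrow> real ^ 'n \<Rightarrow> complex \<Rightarrow> bool" where
  "has_fourier_bohr_coeff \<Gamma> k a \<longleftrightarrow>
     ((\<lambda>r. (\<Sum>x\<in>{x\<in>\<Gamma>. norm x \<le> r}. cis (- (2 * pi * (k \<bullet> x))))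
            / of_real (measure lebesgue (cball (0 :: real ^ 'n) r))) \<longlongrightarrow> a) at_top"

definition deformation ::
    "((real ^ 'n) \<times> (real ^ 'n)) set \<Rightarrow> (real ^ 'n \<Rightarrow> real ^ 'n) \<Rightarrow> real ^ 'n \<Rightarrow> real ^ 'n" where
  "deformation L \<theta> x = x + \<theta> (star_map L x)"

definition deformed_model_set ::
    "((real ^ 'n) \<times> (real ^ 'n)) set \<Rightarrow> (real ^ 'n) set \<Rightarrow> (real ^ 'n \<Rightarrow> real ^ 'n) \<Rightarrow>
     (real ^ 'n) set" where
  "deformed_model_set L W \<theta> = deformation L \<theta> ` model_set L W"

definition inv_fourier_indicator :: "(real ^ 'n) set \<Rightarrow> real ^ 'n \<Rightarrow> complex" where
  "inv_fourier_indicator W k = (LINT y:W|lebesgue. cis (2 * pi * (k \<bullet> y)))"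

definition amplitude ::
    "((real ^ 'n) \<times> (real ^ 'n)) set \<Rightarrow> (real ^ 'n) set \<Rightarrow> real ^ 'n \<Rightarrow> complex" where
  "amplitude L W k =
     of_real (dens (model_set L W) / measure lebesgue W) * inv_fourier_indicator W k"

end

(*
  Let T be a bounded fundamental domain of the lattice L, and for a continuous compactly supported
  weight g on internal space put P r u = (SUM (x, y) in L. [|x + a| <= r] g (y + b)) / vol (B r),
  where u = (a, b).  Because snd ` L is dense, u is within (small internal error) of a lattice
  vector, and translating by a lattice vector only affects points in a shell around the sphere of
  radius r; hence P r u - P r 0 tends to 0 for every u.  On the other hand the integral of P r over
  T unfolds to the integral of g, so dominated convergence gives
  P r 0 --> (integral of g) / vol T.  Windows with null boundary are handled by sandwiching, and the
  deformation again only changes the sums by points in a shell.  On L the character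
  exp (-2 pi i k (x + D y)) equals exp (2 pi i (k* - D^T k) y), a continuous weight.
*)

theory Submission
  imports Defs "HOL-Real_Asymp.Real_Asymp"
begin

section \<open>Fundamental domains of lattices\<close>

lemma measure_lborel_Times:
  fixes A :: "'a::euclidean_space set" and B :: "'b::euclidean_space set"
  assumes "A \<in> sets borel" "B \<in> sets borel"
  shows "measure lborel (A \<times> B) = measure lborel A * measure lborel B"
  unfolding measure_def lborel_prod[symmetric]
  using assms by (simp add: lborel.emeasure_pair_measure_Times enn2real_mult)

text \<open>What is kept of a lattice: a group of translations together with a bounded Borel tile
  whose translates cover every point exactly once. The basis enters only in the construction of
  \<open>D\<close> below, and the covolume is read off as \<open>measure lborel D\<close>.\<close>

locale tiled_lattice =
  fixes L D :: "'a::euclidean_space set"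
  assumes add_mem: "l \<in> L \<Longrightarrow> m \<in> L \<Longrightarrow> l + m \<in> L"
    and uminus_mem: "l \<in> L \<Longrightarrow> - l \<in> L"
    and tile_borel [measurable]: "D \<in> sets borel"
    and bounded_tile: "bounded D"
    and measure_tile_pos: "0 < measure lborel D"
    and tile_ex: "\<exists>l\<in>L. v - l \<in> D"
    and tile_unique: "l \<in> L \<Longrightarrow> m \<in> L \<Longrightarrow> v - l \<in> D \<Longrightarrow> v - m \<in> D \<Longrightarrow> l = m"

text \<open>The tile is the half-open parallelepiped of a basis. Taking floors of the coordinates
  moves any vector into it by a lattice vector, and uniqueness holds because two integers at
  distance less than 1 coincide.\<close>

lemma is_lattice_imp_tiled:
  fixes L :: "'a::euclidean_space set"
  assumes "is_lattice L"
  obtains D where "tiled_lattice L D"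
proof -
  obtain B where B: "independent B" "span B = UNIV"
    and L: "L = {\<Sum>b\<in>B. of_int (c b) *\<^sub>R b | c :: 'a \<Rightarrow> int. True}"
    using assms unfolding is_lattice_def by blast
  have fin: "finite B"
    using B(1) independent_bound by blast
  define R where "R = (\<lambda>v b. representation B v b)"
  have lin: "linear (\<lambda>v. R v b)" for b
    using linear_representation[OF B] by (simp add: R_def linear_def Real_Vector_Spaces.linear_def real_scaleR_def[abs_def])
  have R_sum: "v = (\<Sum>b\<in>B. R v b *\<^sub>R b)" for v
    using sum_representation_eq[OF B(1), of v B] fin B by (auto simp: R_def)
  have R_eq: "R (\<Sum>b\<in>B. c b *\<^sub>R b) b' = c b'" if "b' \<in> B" for c b'
  proof -
    have "R (\<Sum>b\<in>B. c b *\<^sub>R b) b' = (\<Sum>b\<in>B. c b * R b b')"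
      by (subst linear_sum[OF lin]) (simp add: linear_cmul[OF lin])
    also have "\<dots> = (\<Sum>b\<in>B. if b = b' then c b else 0)"
      by (intro sum.cong refl) (use that B(1) representation_basis[OF B(1)] in \<open>auto simp: R_def\<close>)
    finally show ?thesis
      using that fin by simp
  qed
  have mem_L: "v \<in> L \<longleftrightarrow> (\<forall>b\<in>B. R v b \<in> \<int>)" for v
  proof
    assume "v \<in> L" then show "\<forall>b\<in>B. R v b \<in> \<int>"
      unfolding L using R_eq by auto
  next
    assume *: "\<forall>b\<in>B. R v b \<in> \<int>"
    have "v = (\<Sum>b\<in>B. of_int \<lfloor>R v b\<rfloor> *\<^sub>R b)"
      by (subst R_sum) (use * in \<open>auto intro!: sum.cong elim: Ints_cases\<close>)
    then show "v \<in> L" unfolding L by (intro CollectI exI[of _ "\<lambda>b. \<lfloor>R v b\<rfloor>"]) simp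
  qed
  define D where "D = {v. \<forall>b\<in>B. 0 \<le> R v b \<and> R v b < 1}"
  have cont: "continuous_on UNIV (\<lambda>v. R v b)" for b
    by (intro linear_continuous_on linear_linear[THEN iffD2] lin)
  have [measurable]: "(\<lambda>v. R v b) \<in> borel_measurable borel" for b
    using cont by (rule borel_measurable_continuous_onI)
  have borel: "D \<in> sets borel"
    unfolding D_def using fin by measurable
  have bdd: "bounded D"
  proof (rule boundedI)
    fix v assume "v \<in> D"
    have "norm v \<le> (\<Sum>b\<in>B. norm (R v b *\<^sub>R b))"
      by (subst R_sum) (rule norm_sum)
    also have "\<dots> \<le> (\<Sum>b\<in>B. norm b)"
      using \<open>v \<in> D\<close> by (intro sum_mono) (auto simp: D_def intro!: mult_left_le_one_le)
    finally show "norm v \<le> (\<Sum>b\<in>B. norm b)" .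
  qed
  have pos: "0 < measure lborel D"
  proof -
    \<comment> \<open>The open parallelepiped inside \<open>D\<close> is non-empty, since it
      contains its centre; hence \<open>D\<close> has positive measure.\<close>
    define U where "U = (\<Inter>b\<in>B. {v. 0 < R v b} \<inter> {v. R v b < 1})"
    have "open U"
      unfolding U_def using fin
      by (intro open_INT ballI open_Int open_Collect_less cont continuous_on_const)
    moreover have "(\<Sum>b\<in>B. (1/2) *\<^sub>R b) \<in> U"
      using R_eq[of _ "\<lambda>_. 1/2"] by (simp add: U_def) (smt (verit))
    ultimately have "\<not> negligible U"
      using open_not_negligible by blast
    moreover have "U \<subseteq> D"
      by (auto simp: U_def D_def less_imp_le)
    ultimately have "\<not> negligible D"
      using negligible_subset by blast
    moreover have "emeasure lborel D \<noteq> \<infinity>"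
      using bdd emeasure_bounded_finite by fastforce
    ultimately show ?thesis
      using borel by (auto simp: zero_less_measure_iff negligible_iff_emeasure0 emeasure_eq_ennreal_measure)
  qed
  have "tiled_lattice L D"
  proof
    fix l m assume "l \<in> L" "m \<in> L" then show "l + m \<in> L"
      using linear_add[OF lin] by (simp add: mem_L)
  next
    fix l assume "l \<in> L" then show "- l \<in> L"
      using linear_neg[OF lin] by (simp add: mem_L)
  next
    fix v
    define l where "l = (\<Sum>b\<in>B. of_int \<lfloor>R v b\<rfloor> *\<^sub>R b)"
    have "R l b = of_int \<lfloor>R v b\<rfloor>" if "b \<in> B" for b
      using that R_eq unfolding l_def by auto
    then have "l \<in> L" "v - l \<in> D"
      by (auto simp: mem_L D_def linear_diff[OF lin]; linarith)+
    then show "\<exists>l\<in>L. v - l \<in> D" by blast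
  next
    fix l m v assume *: "l \<in> L" "m \<in> L" "v - l \<in> D" "v - m \<in> D"
    have "R l b = R m b" if b: "b \<in> B" for b
    proof -
      obtain i j where ij: "R l b = of_int i" "R m b = of_int j"
        using *(1,2) b unfolding mem_L by (meson Ints_cases)
      have "R (v - l) b \<in> {0..<1}" "R (v - m) b \<in> {0..<1}"
        using *(3,4) b by (auto simp: D_def)
      then have "\<bar>of_int i - of_int j\<bar> < (1::real)"
        by (auto simp: linear_diff[OF lin] ij)
      then have "i = j" by linarith
      then show ?thesis by (simp add: ij)
    qed
    then show "l = m"
      using R_sum[of l] R_sum[of m] by (metis (no_types, lifting) sum.cong)
  qed (fact borel bdd pos)+
  then show ?thesis by (rule that)
qed

section \<open>Packing bounds and unfolding of integrals over the tiles\<close>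

context tiled_lattice
begin

lemma bij_betw_add: "l0 \<in> L \<Longrightarrow> bij_betw (\<lambda>l. l + l0) L L"
  using add_mem[of _ l0] add_mem[of _ "- l0"] uminus_mem[of l0]
  by (intro bij_betw_byWitness[where f' = "\<lambda>l. l + - l0"]) auto

text \<open>The translates of \<open>D\<close> by distinct lattice vectors are disjoint, so those
  contained in \<open>T\<close> have total volume at most that of \<open>T\<close>. All later point
  counts come from this comparison.\<close>

lemma packing:
  assumes "T \<in> sets borel" "bounded T" "P \<subseteq> L" "\<And>l u. l \<in> P \<Longrightarrow> u \<in> D \<Longrightarrow> l + u \<in> T"
  shows "finite P" "real (card P) * measure lborel D \<le> measure lborel T"
proof -
  have D: "D \<in> lmeasurable" and T: "T \<in> lmeasurable"
    using assms bounded_tile by (auto intro: bounded_set_imp_lmeasurable)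
  have fin: "real (card Q) * measure lborel D \<le> measure lborel T" if Q: "finite Q" "Q \<subseteq> P" for Q
  proof -
    have "real (card Q) * measure lborel D = (\<Sum>l\<in>Q. measure lebesgue ((+) l ` D))"
      by (simp add: measure_translation)
    also have "\<dots> = measure lebesgue (\<Union>l\<in>Q. (+) l ` D)"
    proof (rule measure_UNION'[symmetric])
      show "pairwise (\<lambda>l m. disjnt ((+) l ` D) ((+) m ` D)) Q"
      proof (clarsimp simp: pairwise_def disjnt_iff)
        fix l m u u' assume "l \<in> Q" "m \<in> Q" "l \<noteq> m" "u \<in> D" "u' \<in> D" "l + u = m + u'"
        moreover from this have "l + u - m = u'" "l + u - l = u" by (metis add_diff_cancel_left')+
        ultimately show False
          using tile_unique[of l m "l + u"] Q(2) assms(3) by (metis subsetD)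
      qed
    qed (use Q D in \<open>auto simp: measurable_translation\<close>)
    also have "\<dots> \<le> measure lebesgue T"
      using Q D T assms(4) by (intro measure_mono_fmeasurable) (auto intro!: sets.finite_UN fmeasurableD simp: measurable_translation)
    finally show ?thesis using assms by (simp add: measure_completion)
  qed
  \<comment> \<open>The bound is uniform over finite subsets of \<open>P\<close>, which forces
    \<open>P\<close> itself to be finite.\<close>
  have "card Q \<le> nat \<lfloor>measure lborel T / measure lborel D\<rfloor>" if "Q \<subseteq> P" "finite Q" for Q
    using fin[OF that(2,1)] measure_tile_pos by (intro le_nat_floor) (simp add: field_simps)
  then show "finite P" using finite_if_finite_subsets_card_bdd by blast
  then show "real (card P) * measure lborel D \<le> measure lborel T" using fin by blast
qed

lemma finite_bounded:
  assumes "P \<subseteq> L" "bounded P"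
  shows "finite P"
proof -
  obtain a where a: "\<And>l. l \<in> P \<Longrightarrow> norm l \<le> a"
    using assms(2) by (auto simp: bounded_iff)
  obtain d where d: "\<And>u. u \<in> D \<Longrightarrow> norm u \<le> d"
    using bounded_tile by (auto simp: bounded_iff)
  show ?thesis
    by (rule packing(1)[of "cball 0 (a + d)"])
       (use assms(1) a d in \<open>auto intro!: order_trans[OF norm_triangle_ineq] add_mono\<close>)
qed

text \<open>The space is cut into the tiles \<open>l + D\<close> and each piece is translated back
  to \<open>D\<close>. A finite \<open>P\<close> suffices as soon as its tiles cover the support of
  \<open>G\<close>.\<close>

lemma unfolding_integral:
  fixes G :: "'a \<Rightarrow> complex"
  assumes "finite P" "P \<subseteq> L" and [simp]: "integrable lborel G"
    and supp: "\<And>v. G v \<noteq> 0 \<Longrightarrow> \<exists>l\<in>P. v - l \<in> D"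
  shows "(LINT v|lborel. G v) = (LINT u:D|lborel. (\<Sum>l\<in>P. G (u + l)))"
proof -
  have distr: "distr lborel borel ((+) l) = lborel" for l :: 'a
    by (rule lborel_distr_plus)
  have G_meas [measurable]: "G \<in> borel_measurable borel"
    using borel_measurable_integrable[OF assms(3)] by simp
  have int1: "integrable lborel (\<lambda>v. indicator D (v - l) *\<^sub>R G v)" for l
    by (rule Bochner_Integration.integrable_bound[OF assms(3)]) (auto simp: indicator_def)
  have trans: "(LINT v|lborel. F v) = (LINT u|lborel. F (u + l))"
    if [measurable]: "F \<in> borel_measurable borel" for F :: "'a \<Rightarrow> complex" and l
    by (subst distr[symmetric, of l], subst integral_distr) (auto simp: add.commute)
  have trans_int: "integrable lborel F \<longleftrightarrow> integrable lborel (\<lambda>u. F (u + l))"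
    if [measurable]: "F \<in> borel_measurable borel" for F :: "'a \<Rightarrow> complex" and l
    by (subst distr[symmetric, of l], subst integrable_distr_eq) (auto simp: add.commute)
  have "(LINT v|lborel. G v) = (LINT v|lborel. (\<Sum>l\<in>P. indicator D (v - l) *\<^sub>R G v))"
  proof (intro Bochner_Integration.integral_cong refl)
    fix v
    show "G v = (\<Sum>l\<in>P. indicator D (v - l) *\<^sub>R G v)"
    proof (cases "G v = 0")
      case False
      then obtain m where m: "m \<in> P" "v - m \<in> D" using supp by blast
      \<comment> \<open>Exactly one term survives, the one for the tile that contains
        \<open>v\<close>.\<close>
      have "(\<Sum>l\<in>P. indicator D (v - l) *\<^sub>R G v) = (\<Sum>l\<in>P. if l = m then G v else 0)"
        using m assms(2) tile_unique[of _ m v] by (intro sum.cong refl) (auto simp: indicator_def)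
      then show ?thesis using m assms(1) by simp
    qed simp
  qed
  also have "\<dots> = (\<Sum>l\<in>P. LINT v|lborel. indicator D (v - l) *\<^sub>R G v)"
    using int1 by (intro Bochner_Integration.integral_sum) auto
  also have "\<dots> = (\<Sum>l\<in>P. LINT u|lborel. indicator D u *\<^sub>R G (u + l))"
  proof (intro sum.cong refl)
    fix l
    show "(LINT v|lborel. indicator D (v - l) *\<^sub>R G v) = (LINT u|lborel. indicator D u *\<^sub>R G (u + l))"
      by (subst trans[of _ l]) auto
  qed
  also have "\<dots> = (LINT u|lborel. (\<Sum>l\<in>P. indicator D u *\<^sub>R G (u + l)))"
    using int1 trans_int[of "\<lambda>v. indicator D (v - l) *\<^sub>R G v" l for l]
    by (intro Bochner_Integration.integral_sum[symmetric]) auto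
  finally show ?thesis
    by (simp add: set_lebesgue_integral_def scaleR_sum_right)
qed

end

section \<open>Counting lattice points in balls and shells\<close>

text \<open>Ball volumes are proportional to a power of the radius. The constant \<open>c\<close>
  may be negative, which is how the inner radius of a shell is treated.\<close>

lemma ball_volume_ratio_tendsto:
  "((\<lambda>r. measure lborel (cball (0 :: 'a::euclidean_space) (r + c)) / measure lborel (cball (0 :: 'a) r)) \<longlongrightarrow> 1) at_top"
proof -
  have "((\<lambda>r::real. (r + c) / r) \<longlongrightarrow> 1) at_top"
    by real_asymp
  then have "((\<lambda>r. ((r + c) / r) ^ DIM('a)) \<longlongrightarrow> 1 ^ DIM('a)) at_top"
    by (rule tendsto_power)
  then have "((\<lambda>r. ((r + c) / r) ^ DIM('a)) \<longlongrightarrow> 1) at_top" by simp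
  then show ?thesis
  proof (rule Lim_transform_eventually)
    show "\<forall>\<^sub>F r in at_top. ((r + c) / r) ^ DIM('a) =
        measure lborel (cball (0 :: 'a) (r + c)) / measure lborel (cball (0 :: 'a) r)"
      using eventually_gt_at_top[of "\<bar>c\<bar>"]
    proof eventually_elim
      case (elim r)
      then show ?case
        using unit_ball_vol_pos[of "real DIM('a)"] by (simp add: content_cball power_divide del: unit_ball_vol_pos)
    qed
  qed
qed

text \<open>\<open>V\<close> is a parameter because its type does not determine \<open>'a\<close>, so it cannot be a definition in the locale.\<close>

locale tiled_cps = tiled_lattice L D
  for L D :: "('a::euclidean_space \<times> 'b::euclidean_space) set" +
  fixes V :: "real \<Rightarrow> real"
  assumes dense_snd: "closure (snd ` L) = UNIV"
    and V_def: "V = (\<lambda>r. measure lborel (cball (0::'a) r))"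
begin

definition points :: "real \<Rightarrow> real \<Rightarrow> ('a \<times> 'b) set" where
  "points r R = {l \<in> L. norm (fst l) \<le> r \<and> norm (snd l) \<le> R}"

text \<open>Outside this set, moving the physical component by at most \<open>c\<close> cannot carry
  a lattice point of internal norm at most \<open>R\<close> into or out of the ball of radius
  \<open>r\<close>.\<close>

definition shell :: "real \<Rightarrow> real \<Rightarrow> real \<Rightarrow> ('a \<times> 'b) set" where
  "shell c R r = {l \<in> L. \<bar>norm (fst l) - r\<bar> \<le> c \<and> norm (snd l) \<le> R}"

lemma finite_points: "finite (points r R)"
proof (rule finite_bounded)
  show "bounded (points r R)"
    by (rule bounded_subset[OF bounded_Times[OF bounded_cball[of 0 r] bounded_cball[of 0 R]]])
       (auto simp: points_def)
qed (auto simp: points_def)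

lemma shell_subset: "shell c R r \<subseteq> points (r + c) R"
  by (auto simp: shell_def points_def)

lemma finite_shell: "finite (shell c R r)"
  using finite_points shell_subset by (rule rev_finite_subset)

lemma tile_radius: obtains d :: real where "d > 0" "\<And>u. u \<in> D \<Longrightarrow> norm (fst u) \<le> d \<and> norm (snd u) \<le> d"
proof -
  obtain d where d: "d > 0" "\<And>u. u \<in> D \<Longrightarrow> norm u \<le> d"
    using bounded_tile by (auto simp: bounded_pos)
  show ?thesis
  proof (rule that[OF d(1)])
    show "norm (fst u) \<le> d \<and> norm (snd u) \<le> d" if "u \<in> D" for u
      using d(2)[OF that] norm_fst_le[of "fst u" "snd u"] norm_snd_le[of "snd u" "fst u"] by simp
  qed
qed

lemma V_pos: "r > 0 \<Longrightarrow> V r > 0"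
  by (simp add: V_def content_cball_pos)

lemma V_ratio: "((\<lambda>r. V (r + c) / V r) \<longlongrightarrow> 1) at_top"
  unfolding V_def by (rule ball_volume_ratio_tendsto)

text \<open>The tiles attached to these points fit into a product of balls enlarged by the tile
  radius, and enlarging the physical ball by a fixed amount eventually less than doubles its
  volume.\<close>

lemma points_bound:
  obtains K where "K > 0" "\<forall>\<^sub>F r in at_top. real (card (points (r + c) R)) \<le> K * V r"
proof -
  obtain d where d: "d > 0" "\<And>u. u \<in> D \<Longrightarrow> norm (fst u) \<le> d \<and> norm (snd u) \<le> d"
    using tile_radius by blast
  define m where "m = measure lborel (cball (0::'b) (R + d))"
  define \<delta> where "\<delta> = measure lborel D"
  have \<delta>: "\<delta> > 0" unfolding \<delta>_def by (rule measure_tile_pos)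
  have m: "m \<ge> 0" by (simp add: m_def)
  have le: "real (card (points (r + c) R)) * \<delta> \<le> V (r + (c + d)) * m" for r
  proof -
    have "real (card (points (r + c) R)) * \<delta> \<le> measure lborel (cball (0::'a) (r + (c + d)) \<times> cball (0::'b) (R + d))"
      unfolding \<delta>_def
    proof (rule packing(2))
      show "l + u \<in> cball 0 (r + (c + d)) \<times> cball 0 (R + d)" if "l \<in> points (r + c) R" "u \<in> D" for l u
        using that d(2)[of u] norm_triangle_ineq[of "fst l" "fst u"] norm_triangle_ineq[of "snd l" "snd u"]
        by (auto simp: points_def mem_Times_iff)
    qed (auto simp: points_def intro!: bounded_Times borel_closed closed_Times)
    then show ?thesis by (simp add: measure_lborel_Times m_def V_def)
  qed
  have "\<forall>\<^sub>F r in at_top. V (r + (c + d)) / V r < 2"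
    by (rule order_tendstoD[OF V_ratio]) simp
  then have "\<forall>\<^sub>F r in at_top. real (card (points (r + c) R)) \<le> ((2 * m + 1) / \<delta>) * V r"
    using eventually_gt_at_top[of 0]
  proof eventually_elim
    case (elim r)
    then have "V (r + (c + d)) \<le> 2 * V r" using V_pos[of r] by (simp add: field_simps)
    then have "real (card (points (r + c) R)) * \<delta> \<le> 2 * V r * m"
      using le[of r] m by (meson mult_right_mono order_trans)
    also have "\<dots> \<le> (2 * m + 1) * V r" using elim(2) V_pos[of r] by (simp add: algebra_simps)
    finally show ?case using \<delta> by (simp add: field_simps)
  qed
  \<comment> \<open>The summand 1 keeps the constant positive even if \<open>m = 0\<close>, which
    happens when \<open>R + d\<close> is negative.\<close>
  moreover have "(2 * m + 1) / \<delta> > 0" using m \<delta> by (intro divide_pos_pos) auto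
  ultimately show ?thesis using that by blast
qed

text \<open>The tiles attached to the shell fit into an annulus thickened by the tile radius, whose
  volume is of smaller order than \<open>V r\<close> because both of its bounding balls have volume
  asymptotic to \<open>V r\<close>.\<close>

lemma shell_negligible: "((\<lambda>r. real (card (shell c R r)) / V r) \<longlongrightarrow> 0) at_top"
proof -
  obtain d where d: "d > 0" "\<And>u. u \<in> D \<Longrightarrow> norm (fst u) \<le> d \<and> norm (snd u) \<le> d"
    using tile_radius by blast
  define m where "m = measure lborel (cball (0::'b) (R + d))"
  define \<delta> where "\<delta> = measure lborel D"
  have \<delta>: "\<delta> > 0" unfolding \<delta>_def by (rule measure_tile_pos)
  define c' where "c' = \<bar>c\<bar> + d"
  have c': "c' > 0" using d by (simp add: c'_def)
  \<comment> \<open>The inner radius is written \<open>r + - c'\<close> so that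
    \<open>V_ratio\<close> applies to it with the constant \<open>- c'\<close>.\<close>
  have le: "real (card (shell c R r)) * \<delta> \<le> (V (r + c') - V (r + - c')) * m" for r
  proof -
    let ?A = "cball (0::'a) (r + c') - ball (0::'a) (r + - c')"
    have "real (card (shell c R r)) * \<delta> \<le> measure lborel (?A \<times> cball (0::'b) (R + d))"
      unfolding \<delta>_def
    proof (rule packing(2))
      show "l + u \<in> ?A \<times> cball 0 (R + d)" if "l \<in> shell c R r" "u \<in> D" for l u
        using that d(2)[of u] norm_triangle_ineq[of "fst l" "fst u"] norm_triangle_ineq[of "snd l" "snd u"]
          norm_diff_ineq[of "fst l" "fst u"]
        by (auto simp: shell_def mem_Times_iff c'_def)
    qed (auto simp: shell_def intro!: bounded_Times borel_closed closed_Times closed_Diff intro: bounded_subset[OF bounded_cball])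
    also have "\<dots> = measure lborel ?A * m"
      by (simp add: measure_lborel_Times m_def V_def)
    also have "measure lborel ?A = V (r + c') - measure lborel (ball (0::'a) (r + - c'))"
      unfolding V_def using c' emeasure_lborel_cball_finite[of "0::'a" "r + c'"]
      by (intro measure_Diff) (auto simp: subset_iff)
    also have "measure lborel (ball (0::'a) (r + - c')) = V (r + - c')"
      by (simp add: content_cball_conv_ball V_def)
    finally show ?thesis .
  qed
  have "((\<lambda>r. (V (r + c') / V r - V (r + - c') / V r) * m / \<delta>) \<longlongrightarrow> (1 - 1) * m / \<delta>) at_top"
    using \<delta> by (intro tendsto_intros V_ratio) auto
  then have lim: "((\<lambda>r. (V (r + c') / V r - V (r + - c') / V r) * m / \<delta>) \<longlongrightarrow> 0) at_top"
    by simp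
  show ?thesis
  proof (rule tendsto_sandwich[OF _ _ tendsto_const lim])
    show "\<forall>\<^sub>F r in at_top. real (card (shell c R r)) / V r \<le> (V (r + c') / V r - V (r + - c') / V r) * m / \<delta>"
      using eventually_gt_at_top[of 0]
    proof eventually_elim
      case (elim r)
      then show ?case using le[of r] V_pos[of r] \<delta> by (simp add: field_simps)
    qed
  qed (simp add: V_def)
qed

end

section \<open>Equidistribution for continuous weights\<close>

lemma bounded_of_support_cball:
  fixes g :: "'a::euclidean_space \<Rightarrow> 'b::real_normed_vector"
  assumes cont: "continuous_on UNIV g" and supp: "\<And>y. norm y > R \<Longrightarrow> g y = 0"
  shows "bounded (range g)"
proof -
  have "compact (g ` cball 0 R)"
    by (intro compact_continuous_image continuous_on_subset[OF cont]) auto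
  then have "bounded (insert 0 (g ` cball 0 R))"
    by (simp add: compact_imp_bounded)
  moreover have "range g \<subseteq> insert 0 (g ` cball 0 R)"
    using supp by (force simp: not_less)
  ultimately show ?thesis by (rule bounded_subset)
qed

section \<open>Moving the base point, and averaging over a tile\<close>

context tiled_cps
begin

definition cut :: "('b \<Rightarrow> complex) \<Rightarrow> real \<Rightarrow> 'a \<times> 'b \<Rightarrow> complex" where
  "cut g r v = (if norm (fst v) \<le> r then g (snd v) else 0)"

text \<open>Summing over all of \<open>L\<close> makes invariance under lattice translations a mere
  reindexing. For weights supported in a ball only finitely many terms are non-zero, and
  \<open>lattice_sum_eq\<close> passes to a finite sum.\<close>

definition lattice_sum :: "('b \<Rightarrow> complex) \<Rightarrow> real \<Rightarrow> 'a \<times> 'b \<Rightarrow> complex" where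
  "lattice_sum g r u = (\<Sum>\<^sub>\<infinity>l\<in>L. cut g r (u + l))"

lemma lattice_sum_eq:
  assumes "points r' R' \<subseteq> Q" "Q \<subseteq> L" "finite Q"
    and "\<And>l. l \<in> L \<Longrightarrow> cut g r (u + l) \<noteq> 0 \<Longrightarrow> norm (fst l) \<le> r' \<and> norm (snd l) \<le> R'"
  shows "lattice_sum g r u = (\<Sum>l\<in>Q. cut g r (u + l))"
proof -
  have "lattice_sum g r u = infsum (\<lambda>l. cut g r (u + l)) Q"
    unfolding lattice_sum_def
    by (rule infsum_cong_neutral) (use assms in \<open>auto simp: points_def\<close>)
  then show ?thesis using assms(3) by simp
qed

lemma lattice_sum_shift:
  assumes "l0 \<in> L"
  shows "lattice_sum g r (u + l0) = lattice_sum g r u"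
  unfolding lattice_sum_def
  using infsum_reindex_bij_betw[OF bij_betw_add[OF assms], of "\<lambda>l. cut g r (u + l)"]
  by (simp add: add_ac)

text \<open>This is where density of the internal projection acts: modulo \<open>L\<close>, the
  shift \<open>u\<close> becomes a shift \<open>v\<close> with tiny internal part. Its physical part
  may be large, but it does not depend on \<open>r\<close>, so it only affects a shell of fixed
  width.\<close>

lemma lattice_sum_difference_negligible:
  fixes g :: "'b \<Rightarrow> complex"
  assumes cont: "continuous_on UNIV g" and supp: "\<And>y. norm y > R \<Longrightarrow> g y = 0"
  shows "((\<lambda>r. (lattice_sum g r u - lattice_sum g r 0) / of_real (V r)) \<longlongrightarrow> 0) at_top"
proof (rule tendstoI)
  fix e :: real assume e: "e > 0"
  obtain M where M: "M > 0" "\<And>y. norm (g y) \<le> M"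
    using bounded_of_support_cball[OF cont supp] by (auto simp: bounded_pos)
  obtain K where K: "K > 0" "\<forall>\<^sub>F r in at_top. real (card (points (r + 0) (R + 1))) \<le> K * V r"
    by (rule points_bound)
  \<comment> \<open>Chosen so that at most \<open>K * V r\<close> points, each with error
    \<open>e'\<close>, contribute at most \<open>e / 2 * V r\<close>.\<close>
  define e' where "e' = e / (2 * K)"
  have e': "e' > 0" using e K by (simp add: e'_def)
  have "uniformly_continuous_on (cball 0 (R + 1)) g"
    by (intro compact_uniformly_continuous continuous_on_subset[OF cont]) auto
  then obtain \<delta>0 where \<delta>0: "\<delta>0 > 0"
    "\<And>y y'. y \<in> cball 0 (R + 1) \<Longrightarrow> y' \<in> cball 0 (R + 1) \<Longrightarrow> dist y y' < \<delta>0 \<Longrightarrow> dist (g y) (g y') < e'"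
    using e' unfolding uniformly_continuous_on_def by metis
  \<comment> \<open>The cap at 1 keeps both arguments in \<open>cball 0 (R + 1)\<close> as soon as
    one of them has norm at most \<open>R\<close>; uniform continuity on this compact ball is then
    enough.\<close>
  define \<delta> where "\<delta> = min \<delta>0 1"
  have \<delta>: "\<delta> > 0" "\<delta> \<le> 1" using \<delta>0 by (auto simp: \<delta>_def)
  have unif: "norm (g (y + z) - g y) \<le> e'" if z: "norm z < \<delta>" for y z
  proof (cases "norm y \<le> R \<or> norm (y + z) \<le> R")
    case True
    then have "norm y \<le> R + 1" "norm (y + z) \<le> R + 1"
      using z \<delta>(2) norm_triangle_ineq[of y z] norm_triangle_ineq4[of "y + z" z] by auto
    then have "y \<in> cball 0 (R + 1)" "y + z \<in> cball 0 (R + 1)"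
      by (simp_all only: mem_cball_0)
    then have "dist (g (y + z)) (g y) < e'"
      using \<delta>0(2)[of "y + z" y] z by (simp add: dist_norm[of "y + z"] \<delta>_def)
    then show ?thesis by (simp add: dist_norm)
  next
    case False
    then show ?thesis using supp[of y] supp[of "y + z"] e' by simp
  qed
  have "snd u \<in> closure (snd ` L)" using dense_snd by simp
  then obtain l0 where l0: "l0 \<in> L" "dist (snd l0) (snd u) < \<delta>"
    unfolding closure_approachable using \<delta>(1) by blast
  define v where "v = u + - l0"
  have v: "norm (snd v) < \<delta>"
    using l0(2) by (simp add: v_def dist_norm norm_minus_commute)
  define c where "c = norm (fst v)"
  have shift: "lattice_sum g r u = lattice_sum g r v" for r
    unfolding v_def using uminus_mem[OF l0(1)] by (rule lattice_sum_shift[symmetric])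
  have bound: "norm (lattice_sum g r u - lattice_sum g r 0)
      \<le> e' * real (card (points r (R + 1))) + 2 * M * real (card (shell c (R + 1) r))" for r
  proof -
    \<comment> \<open>One index set for both sums: points of physical norm between \<open>r\<close>
      and \<open>r + c\<close> lie in the shell, so \<open>Q\<close> holds every non-zero term for
      the shift \<open>v\<close> and for the shift 0.\<close>
    define Q where "Q = points r (R + 1) \<union> shell c (R + 1) r"
    have Q: "finite Q" "Q \<subseteq> L"
      by (simp add: Q_def finite_points finite_shell, auto simp: Q_def points_def shell_def)
    have Q_mem: "l \<in> Q" if "l \<in> L" "norm (fst l) \<le> r + c" "norm (snd l) \<le> R + 1" for l
      using that by (auto simp: Q_def points_def shell_def)
    have far: "norm (fst l) \<le> r + c" if "norm (fst v + fst l) \<le> r" for l :: "'a \<times> 'b"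
      using that norm_triangle_ineq4[of "fst v + fst l" "fst v"] by (simp add: c_def)
    have far2: "norm (snd l) \<le> R + 1" if "g (snd v + snd l) \<noteq> 0" for l :: "'a \<times> 'b"
      using that supp[of "snd v + snd l"] v \<delta>(2) norm_triangle_ineq4[of "snd v + snd l" "snd v"] by fastforce
    have c0: "c \<ge> 0" by (simp add: c_def)
    have 1: "lattice_sum g r v = (\<Sum>l\<in>Q. cut g r (v + l))"
      using Q_mem far far2
      by (intro lattice_sum_eq[of "r + c" "R + 1"] Q) (auto simp: cut_def points_def split: if_splits)
    have 2: "lattice_sum g r 0 = (\<Sum>l\<in>Q. cut g r (0 + l))"
      using Q_mem c0 supp
      by (intro lattice_sum_eq[of "r + c" "R + 1"] Q) (force simp: cut_def points_def split: if_splits)+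
    have term_le: "norm (cut g r (v + l) - cut g r l)
        \<le> (if l \<in> points r (R + 1) then e' else 0) + (if l \<in> shell c (R + 1) r then 2 * M else 0)"
      if "l \<in> Q" for l
    proof (cases "l \<in> shell c (R + 1) r")
      case True
      have "norm (cut g r (v + l) - cut g r l) \<le> norm (cut g r (v + l)) + norm (cut g r l)"
        by (rule norm_triangle_ineq4)
      also have "\<dots> \<le> M + M"
        using M by (intro add_mono) (auto simp: cut_def less_imp_le)
      finally show ?thesis using True e' by auto
    next
      case False
      \<comment> \<open>Away from the shell both cutoffs let the point through, so only the
        variation of \<open>g\<close> remains; inside the shell the crude bound \<open>2 * M\<close>
        is used.\<close>
      with that have l: "l \<in> points r (R + 1)" "norm (fst l) < r - c"
        by (auto simp: Q_def points_def shell_def)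
      then have "norm (fst v + fst l) \<le> r" "norm (fst l) \<le> r"
        using norm_triangle_ineq[of "fst v" "fst l"] norm_ge_zero[of "fst v"] by (auto simp: c_def simp del: norm_ge_zero)
      then have "cut g r (v + l) - cut g r l = g (snd l + snd v) - g (snd l)"
        by (simp add: cut_def add.commute)
      then show ?thesis using unif[OF v] l(1) False by simp
    qed
    have "norm (lattice_sum g r u - lattice_sum g r 0) = norm (\<Sum>l\<in>Q. cut g r (v + l) - cut g r l)"
      by (simp add: shift 1 2 sum_subtractf)
    also have "\<dots> \<le> (\<Sum>l\<in>Q. (if l \<in> points r (R + 1) then e' else 0) + (if l \<in> shell c (R + 1) r then 2 * M else 0))"
      by (intro order_trans[OF norm_sum] sum_mono term_le)
    also have "\<dots> = (\<Sum>l\<in>points r (R + 1). e') + (\<Sum>l\<in>shell c (R + 1) r. 2 * M)"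
      unfolding sum.distrib
      by (intro arg_cong2[where f = "(+)"] sum.mono_neutral_cong_right Q) (auto simp: Q_def)
    finally show ?thesis by (simp add: mult.commute)
  qed
  have "((\<lambda>r. 2 * M * (real (card (shell c (R + 1) r)) / V r)) \<longlongrightarrow> 2 * M * 0) at_top"
    by (intro tendsto_intros shell_negligible)
  then have "\<forall>\<^sub>F r in at_top. 2 * M * (real (card (shell c (R + 1) r)) / V r) < e / 2"
    by (rule order_tendstoD) (use e in simp)
  then show "\<forall>\<^sub>F r in at_top. dist ((lattice_sum g r u - lattice_sum g r 0) / of_real (V r)) 0 < e"
    using K(2) eventually_gt_at_top[of 0]
  proof eventually_elim
    case (elim r)
    have V: "V r > 0" using elim(3) by (rule V_pos)
    have "norm (lattice_sum g r u - lattice_sum g r 0) \<le> e' * (K * V r) + 2 * M * real (card (shell c (R + 1) r))"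
      using bound[of r] elim(2) e' by (smt (verit) mult_left_mono add.right_neutral)
    also have "e' * (K * V r) = e / 2 * V r" using K(1) by (simp add: e'_def)
    also have "2 * M * real (card (shell c (R + 1) r)) < e / 2 * V r"
      using elim(1) V by (simp add: field_simps)
    finally show ?case using V by (simp add: norm_divide field_simps)
  qed
qed

text \<open>The limit is identified by averaging: the integral over \<open>D\<close> of the shifted
  sums is known exactly for each \<open>r\<close>, and by the preceding lemma the unshifted sum
  differs from every shifted one by a negligible amount.\<close>

theorem lattice_sum_tendsto:
  fixes g :: "'b \<Rightarrow> complex"
  assumes cont: "continuous_on UNIV g" and supp: "\<And>y. norm y > R \<Longrightarrow> g y = 0"
  shows "((\<lambda>r. (\<Sum>l\<in>points r R. g (snd l)) / of_real (V r))
    \<longlongrightarrow> (LINT y|lborel. g y) / of_real (measure lborel D)) at_top"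
proof -
  obtain d where d: "d > 0" "\<And>u. u \<in> D \<Longrightarrow> norm (fst u) \<le> d \<and> norm (snd u) \<le> d"
    using tile_radius by blast
  have [measurable]: "g \<in> borel_measurable borel"
    using cont by (rule borel_measurable_continuous_onI)
  have [measurable]: "cut g r \<in> borel_measurable borel" for r
    unfolding cut_def[abs_def] borel_prod[symmetric] by measurable
  obtain M where M: "M > 0" "\<And>y. norm (g y) \<le> M"
    using bounded_of_support_cball[OF cont supp] by (auto simp: bounded_pos)
  \<comment> \<open>Enlarging both radii by the tile radius gives one finite index set valid for all
    shifts \<open>u\<close> in \<open>D\<close>.\<close>
  define P where "P r = points (r + d) (R + d)" for r
  have sum_P: "lattice_sum g r u = (\<Sum>l\<in>P r. cut g r (u + l))" if "norm (fst u) \<le> d" "norm (snd u) \<le> d" for r u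
  proof (rule lattice_sum_eq[of "r + d" "R + d"])
    fix l assume "cut g r (u + l) \<noteq> 0"
    then have "norm (fst u + fst l) \<le> r" "norm (snd u + snd l) \<le> R"
      using supp[of "snd u + snd l"] by (auto simp: cut_def split: if_splits) fastforce
    then show "norm (fst l) \<le> r + d \<and> norm (snd l) \<le> R + d"
      using that norm_triangle_ineq4[of "fst u + fst l" "fst u"] norm_triangle_ineq4[of "snd u + snd l" "snd u"] by simp
  qed (use finite_points in \<open>auto simp: P_def points_def\<close>)
  have zero: "lattice_sum g r 0 = (\<Sum>l\<in>points r R. g (snd l))" for r
  proof -
    have "lattice_sum g r 0 = (\<Sum>l\<in>points r R. cut g r (0 + l))"
      by (rule lattice_sum_eq[of r R])
         (use finite_points supp in \<open>force simp: cut_def points_def split: if_splits\<close>)+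
    also have "\<dots> = (\<Sum>l\<in>points r R. g (snd l))"
      by (intro sum.cong) (auto simp: cut_def points_def)
    finally show ?thesis .
  qed
  have int_cut: "integrable lborel (cut g r)" for r
  proof (rule Bochner_Integration.integrable_bound)
    show "integrable lborel (\<lambda>v. indicator (cball (0::'a) r \<times> cball (0::'b) R) v *\<^sub>R M)"
      by (intro integrable_scaleR_left integrable_real_indicator emeasure_bounded_finite bounded_Times)
         (auto intro!: borel_closed closed_Times)
    show "AE v in lborel. norm (cut g r v) \<le> norm (indicator (cball (0::'a) r \<times> cball (0::'b) R) v *\<^sub>R M)"
      using M supp by (intro always_eventually allI) (force simp: cut_def indicator_def mem_Times_iff)
  qed simp
  \<comment> \<open>Fubini: the cutoff separates into a ball in the physical variable and
    \<open>g\<close> in the internal one.\<close>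
  have int_total: "(LINT v|lborel. cut g r v) = of_real (V r) * (LINT y|lborel. g y)" for r
  proof -
    have "(LINT v|lborel. cut g r v) = (LINT v|(lborel \<Otimes>\<^sub>M lborel). cut g r v)"
      by (simp add: lborel_prod)
    also have "\<dots> = (LINT x|lborel. (LINT y|lborel. cut g r (x, y)))"
      using int_cut[of r] by (intro lborel_pair.integral_fst'[symmetric]) (simp add: lborel_prod)
    also have "\<dots> = (LINT x|lborel. indicator (cball (0::'a) r) x *\<^sub>R (LINT y|lborel. g y))"
      by (intro Bochner_Integration.integral_cong refl) (auto simp: cut_def indicator_def)
    also have "\<dots> = of_real (V r) * (LINT y|lborel. g y)"
      by (subst integral_scaleR_left[OF integrable_real_indicator[OF _ emeasure_bounded_finite]])
         (auto simp: V_def scaleR_conv_of_real)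
    finally show ?thesis .
  qed
  have unfolded: "(LINT u:D|lborel. (\<Sum>l\<in>P r. cut g r (u + l))) = of_real (V r) * (LINT y|lborel. g y)" for r
  proof -
    have "(LINT v|lborel. cut g r v) = (LINT u:D|lborel. (\<Sum>l\<in>P r. cut g r (u + l)))"
    proof (rule unfolding_integral)
      fix v assume v: "cut g r v \<noteq> 0"
      obtain l where l: "l \<in> L" "v - l \<in> D" using tile_ex by blast
      have "norm (fst v) \<le> r" "norm (snd v) \<le> R"
        using v supp[of "snd v"] by (auto simp: cut_def split: if_splits) fastforce
      then have "l \<in> P r"
        using l d(2)[OF l(2)] norm_triangle_ineq4[of "fst v" "fst (v - l)"] norm_triangle_ineq4[of "snd v" "snd (v - l)"]
        by (auto simp: P_def points_def)
      with l show "\<exists>l\<in>P r. v - l \<in> D" by blast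
    qed (use int_cut finite_points in \<open>auto simp: P_def points_def\<close>)
    then show ?thesis using int_total by simp
  qed
  obtain K where K: "K > 0" "\<forall>\<^sub>F r in at_top. real (card (points (r + d) (R + d))) \<le> K * V r"
    using points_bound by blast
  have norm_le: "norm (lattice_sum g r u) \<le> M * real (card (P r))" if "norm (fst u) \<le> d" "norm (snd u) \<le> d" for r u
  proof -
    have "norm (lattice_sum g r u) \<le> (\<Sum>l\<in>P r. M)"
      unfolding sum_P[OF that] using M by (intro order_trans[OF norm_sum] sum_mono) (auto simp: cut_def less_imp_le)
    then show ?thesis by (simp add: mult.commute)
  qed
  \<comment> \<open>The finite sum over \<open>P r\<close> stands in for
    \<open>lattice_sum g r u\<close>, with which it agrees on \<open>D\<close>; in this form
    measurability in \<open>u\<close> is immediate.\<close>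
  define F where "F r u = indicator D u *\<^sub>R (((\<Sum>l\<in>P r. cut g r (u + l)) - lattice_sum g r 0) / of_real (V r))" for r u
  have F_eq: "F r u = (lattice_sum g r u - lattice_sum g r 0) / of_real (V r)" if "u \<in> D" for r u
    using that d(2) by (simp add: F_def sum_P)
  have "((\<lambda>r. LINT u|lborel. F r u) \<longlongrightarrow> (LINT u|(lborel :: ('a \<times> 'b) measure). (0::complex))) at_top"
  \<comment> \<open>Each of the two sums has norm at most \<open>M\<close> times
    \<open>card (P r)\<close>, and \<open>points_bound\<close> gives \<open>K * V r\<close> for the
    latter, whence the bound \<open>2 * M * K\<close> on the tile.\<close>
  proof (rule integral_dominated_convergence_at_top[where w = "\<lambda>u. indicator D u *\<^sub>R (2 * M * K)"])
    show "F r \<in> borel_measurable lborel" for r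
      unfolding F_def by measurable
    show "integrable lborel (\<lambda>u. indicator D u *\<^sub>R (2 * M * K))"
      using bounded_tile by (intro integrable_scaleR_left integrable_real_indicator emeasure_bounded_finite) auto
    show "\<forall>\<^sub>F r in at_top. AE u in lborel. norm (F r u) \<le> indicator D u *\<^sub>R (2 * M * K)"
      using K(2) eventually_gt_at_top[of 0]
    proof eventually_elim
      case (elim r)
      have V: "V r > 0" using elim(2) by (rule V_pos)
      have "norm (F r u) \<le> indicator D u *\<^sub>R (2 * M * K)" for u
      proof (cases "u \<in> D")
        case True
        have "norm (lattice_sum g r u - lattice_sum g r 0) \<le> M * real (card (P r)) + M * real (card (P r))"
          using d True by (intro order_trans[OF norm_triangle_ineq4] add_mono norm_le) auto
        also have "\<dots> \<le> 2 * M * (K * V r)"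
          using elim(1) M(1) by (simp add: P_def)
        finally show ?thesis
          using True V by (simp add: F_eq[OF True] norm_divide field_simps)
      qed (simp add: F_def)
      then show ?case by simp
    qed
    show "AE u in lborel. ((\<lambda>r. F r u) \<longlongrightarrow> 0) at_top"
    proof (intro always_eventually allI)
      fix u
      show "((\<lambda>r. F r u) \<longlongrightarrow> 0) at_top"
      proof (cases "u \<in> D")
        case True
        then show ?thesis
          using lattice_sum_difference_negligible[OF cont supp] by (simp add: F_eq)
      qed (simp add: F_def)
    qed
  qed simp_all
  moreover have "\<forall>\<^sub>F r in at_top. (LINT u|lborel. F r u)
      = (LINT y|lborel. g y) - of_real (measure lborel D) * (lattice_sum g r 0 / of_real (V r))"
    using eventually_gt_at_top[of 0]
  proof eventually_elim
    case (elim r)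
    have V: "V r > 0" using elim by (rule V_pos)
    have fin: "emeasure lborel D < \<infinity>" using bounded_tile by (rule emeasure_bounded_finite)
    have int1: "integrable lborel (\<lambda>u. indicator D u *\<^sub>R (\<Sum>l\<in>P r. cut g r (u + l)))"
    proof (rule Bochner_Integration.integrable_bound)
      show "integrable lborel (\<lambda>u. indicator D u *\<^sub>R (M * real (card (P r))))"
        using fin by (intro integrable_real_indicator integrable_scaleR_left) auto
      show "AE u in lborel. norm (indicator D u *\<^sub>R (\<Sum>l\<in>P r. cut g r (u + l))) \<le> norm (indicator D u *\<^sub>R (M * real (card (P r))))"
        using norm_le sum_P d(2) M(1) by (intro always_eventually allI) (auto simp: indicator_def)
    qed measurable
    have int2: "integrable lborel (\<lambda>u. indicator D u *\<^sub>R lattice_sum g r 0)"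
      using fin by (intro integrable_real_indicator integrable_scaleR_left) auto
    have "(LINT u|lborel. F r u) = (LINT u|lborel. (indicator D u *\<^sub>R (\<Sum>l\<in>P r. cut g r (u + l))
        - indicator D u *\<^sub>R lattice_sum g r 0) / of_real (V r))"
      by (intro Bochner_Integration.integral_cong refl) (simp add: F_def indicator_def)
    also have "\<dots> = ((LINT u|lborel. indicator D u *\<^sub>R (\<Sum>l\<in>P r. cut g r (u + l)))
        - (LINT u|lborel. indicator D u *\<^sub>R lattice_sum g r 0)) / of_real (V r)"
      using int1 int2 by (simp add: Bochner_Integration.integral_diff)
    also have "(LINT u|lborel. indicator D u *\<^sub>R (\<Sum>l\<in>P r. cut g r (u + l))) = of_real (V r) * (LINT y|lborel. g y)"
      using unfolded[of r] by (simp add: set_lebesgue_integral_def)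
    also have "(LINT u|lborel. indicator D u *\<^sub>R lattice_sum g r 0) = of_real (measure lborel D) * lattice_sum g r 0"
      using fin by (subst integral_scaleR_left) (auto simp: scaleR_conv_of_real)
    finally show ?case using V by (simp add: diff_divide_distrib)
  qed
  ultimately have "((\<lambda>r. (LINT y|lborel. g y) - of_real (measure lborel D) * (lattice_sum g r 0 / of_real (V r))) \<longlongrightarrow> 0) at_top"
    by (simp add: filterlim_cong)
  then have "((\<lambda>r. ((LINT y|lborel. g y) - ((LINT y|lborel. g y) - of_real (measure lborel D) * (lattice_sum g r 0 / of_real (V r))))
      / of_real (measure lborel D)) \<longlongrightarrow> ((LINT y|lborel. g y) - 0) / of_real (measure lborel D)) at_top"
    using measure_tile_pos by (intro tendsto_intros) auto
  then show ?thesis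
    using measure_tile_pos by (simp add: zero)
qed

end

section \<open>Windows with null boundary\<close>

text \<open>A tent function \<open>q\<close> of height 1 around the frontier absorbs the jump of the
  indicator. As the tents narrow, their integrals tend to the measure of the frontier, which is
  0.\<close>

lemma window_approximation:
  fixes W :: "'b::euclidean_space set"
  assumes W: "bounded W" "W \<noteq> {}" "negligible (frontier W)" and e: "e > 0"
  obtains p q :: "'b \<Rightarrow> real" and R where
    "continuous_on UNIV p" "continuous_on UNIV q"
    "\<And>y. norm y > R \<Longrightarrow> p y = 0 \<and> q y = 0 \<and> y \<notin> W"
    "\<And>y. \<bar>indicator W y - p y\<bar> \<le> q y" "integrable lborel q" "(LINT y|lborel. q y) < e"
proof -
  define Z where "Z = frontier W"
  \<comment> \<open>A bounded non-empty set is not the whole space, so its frontier is non-empty.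
    This matters because \<open>infdist\<close> to the empty set is 0 by convention.\<close>
  have Z: "closed Z" "bounded Z" "Z \<noteq> {}"
    using W bounded_subset[OF bounded_closure[OF W(1)]] frontier_eq_empty[of W] not_bounded_UNIV by (auto simp: Z_def frontier_def)
  obtain a where a: "\<And>y. y \<in> W \<union> Z \<Longrightarrow> norm y \<le> a"
    using W(1) Z(2) by (metis bounded_Un bounded_iff)
  define q where "q j y = max 0 (1 - real (Suc j) * infdist y Z)" for j :: nat and y
  have cont_q: "continuous_on UNIV (q j)" for j
    unfolding q_def by (intro continuous_intros)
  have q_le: "0 \<le> q j y" "q j y \<le> 1" for j y
    by (auto simp: q_def infdist_nonneg)
  have q_frontier: "q j y = 1" if "y \<in> Z" for j y
    using that by (simp add: q_def)
  have q_supp: "q j y = 0" if "norm y > a + 1" for j y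
  proof -
    obtain z where z: "z \<in> Z" "infdist y Z = dist y z"
      using infdist_attains_inf[OF Z(1,3)] by metis
    then have "infdist y Z \<ge> 1"
      using that a[of z] norm_triangle_ineq2[of y z] by (simp add: dist_norm)
    then have "1 * 1 \<le> real (Suc j) * infdist y Z" by (intro mult_mono) auto
    then show ?thesis by (simp add: q_def)
  qed
  define w where "w = (\<lambda>y::'b. indicator (cball 0 (a + 1)) y *\<^sub>R (1::real))"
  have int_w: "integrable lborel w"
    unfolding w_def by (intro integrable_scaleR_left integrable_real_indicator emeasure_bounded_finite) auto
  have q_w: "norm (q j y) \<le> w y" for j y
    using q_le[of j y] q_supp[of y j] by (auto simp: w_def indicator_def not_le)
  have meas_q: "q j \<in> borel_measurable lborel" for j
    using borel_measurable_continuous_onI[OF cont_q[of j]] by simp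
  have int_q: "integrable lborel (q j)" for j
    by (rule Bochner_Integration.integrable_bound[OF int_w meas_q])
       (intro always_eventually allI order_trans[OF q_w], simp)
  have "(\<lambda>j. LINT y|lborel. q j y) \<longlonglongrightarrow> (LINT y|lborel. (indicator Z y :: real))"
  proof (rule integral_dominated_convergence[OF _ meas_q int_w])
    show "AE y in lborel. (\<lambda>j. q j y) \<longlonglongrightarrow> indicator Z y"
    proof (intro always_eventually allI)
      fix y
      show "(\<lambda>j. q j y) \<longlonglongrightarrow> indicator Z y"
      proof (cases "y \<in> Z")
        case True then show ?thesis by (simp add: q_frontier)
      next
        case False
        then have pos: "infdist y Z > 0"
          using Z infdist_pos_not_in_closed by blast
        obtain N :: nat where N: "1 < real N * infdist y Z"
          using reals_Archimedean3[OF pos] by blast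
        have "q j y = 0" if "j \<ge> N" for j
        proof -
          have "real N * infdist y Z \<le> real (Suc j) * infdist y Z"
            using that pos by (intro mult_right_mono) auto
          then show ?thesis using N by (simp add: q_def)
        qed
        then show ?thesis
          using False by (intro tendsto_eventually) (auto simp: eventually_sequentially)
      qed
    qed
  qed (use q_w Z in \<open>auto intro: borel_closed\<close>)
  moreover have "(LINT y|lborel. (indicator Z y :: real)) = 0"
  proof -
    have "emeasure lborel Z = 0"
      using W(3) Z(1) by (simp add: Z_def negligible_iff_emeasure0 borel_closed)
    then show ?thesis using Z(1) by (simp add: borel_closed measure_def)
  qed
  ultimately have "\<forall>\<^sub>F j in sequentially. (LINT y|lborel. q j y) < e"
    using e by (intro order_tendstoD) auto
  then obtain j where j: "(LINT y|lborel. q j y) < e"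
    by (auto simp: eventually_sequentially)
  define p where "p y = (if y \<in> W then 1 - q j y else 0)" for y
  \<comment> \<open>The two branches of \<open>p\<close> meet only over the frontier, where
    \<open>q j\<close> is 1 and both give 0.\<close>
  have "continuous_on (closure W \<union> closure (- W)) p"
    unfolding p_def
  proof (rule continuous_on_cases)
    show "\<forall>y. y \<in> closure W \<and> y \<notin> W \<or> y \<in> closure (- W) \<and> y \<in> W \<longrightarrow> 1 - q j y = 0"
    proof (intro allI impI)
      fix y assume "y \<in> closure W \<and> y \<notin> W \<or> y \<in> closure (- W) \<and> y \<in> W"
      then have "y \<in> Z"
        using closure_subset[of W] closure_subset[of "- W"] unfolding Z_def frontier_closures by blast
      then show "1 - q j y = 0" by (simp add: q_frontier)
    qed
  qed (auto intro!: continuous_intros continuous_on_subset[OF cont_q])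
  moreover have "closure W \<union> closure (- W) = UNIV"
    by (simp flip: closure_Un)
  ultimately have cont_p: "continuous_on UNIV p" by simp
  show ?thesis
  proof (rule that[OF cont_p cont_q _ _ int_q j])
    show "p y = 0 \<and> q j y = 0 \<and> y \<notin> W" if "norm y > a + 1" for y
      using that a[of y] q_supp[of y j] by (auto simp: p_def)
    show "\<bar>indicator W y - p y\<bar> \<le> q j y" for y
      using q_le[of j y] by (auto simp: p_def)
  qed
qed

section \<open>Sums over a window with displaced points\<close>

context tiled_cps
begin

text \<open>Replacing the window by \<open>p\<close> costs at most \<open>q\<close>, in the sum as
  well as in the integral, and a bounded displacement costs at most a shell. Zero displacement with
  weight 1 will yield the density, a linear displacement the deformed model set.\<close>

theorem weighted_model_set_sum_tendsto:
  fixes f :: "'b \<Rightarrow> complex" and \<theta> :: "'b \<Rightarrow> 'a"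
  assumes W: "bounded W" "W \<noteq> {}" "negligible (frontier W)"
    and f: "continuous_on UNIV f" "\<And>y. norm (f y) \<le> 1"
    and \<theta>: "bounded (\<theta> ` W)"
  shows "((\<lambda>r. (\<Sum>l\<in>{l\<in>L. snd l \<in> W \<and> norm (fst l + \<theta> (snd l)) \<le> r}. f (snd l)) / of_real (V r))
    \<longlongrightarrow> (LINT y:W|lebesgue. f y) / of_real (measure lborel D)) at_top"
proof (rule tendstoI)
  fix e :: real assume e: "e > 0"
  define \<delta> where "\<delta> = measure lborel D"
  have \<delta>: "\<delta> > 0" unfolding \<delta>_def by (rule measure_tile_pos)
  obtain p q :: "'b \<Rightarrow> real" and R where
    cont: "continuous_on UNIV p" "continuous_on UNIV q"
    and supp: "\<And>y. norm y > R \<Longrightarrow> p y = 0 \<and> q y = 0 \<and> y \<notin> W"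
    and pq: "\<And>y. \<bar>indicator W y - p y\<bar> \<le> q y"
    and int_q: "integrable lborel q" and q_small: "(LINT y|lborel. q y) < e * \<delta> / 5"
    \<comment> \<open>The factor \<open>\<delta>\<close> offsets the later division by the covolume.
      Four errors below \<open>e / 5\<close> arise: from \<open>q\<close> in the sum, from the
      shell, from the limit of \<open>S0\<close>, and from \<open>J - I\<close>.\<close>
    using window_approximation[OF W, of "e * \<delta> / 5"] e \<delta> by auto
  define I where "I = (LINT y:W|lebesgue. f y)"
  define J where "J = (LINT y|lborel. f y * of_real (p y))"
  have cont_fp: "continuous_on UNIV (\<lambda>y. f y * of_real (p y))"
    by (intro continuous_intros cont f)
  have WR: "norm y \<le> R" if "y \<in> W" for y
    using supp[of y] that by fastforce
  obtain c where c: "\<And>y. y \<in> W \<Longrightarrow> norm (\<theta> y) \<le> c"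
    using \<theta> by (auto simp: bounded_iff)
  have IJ: "norm (J - I) \<le> (LINT y|lborel. q y)"
  proof -
    \<comment> \<open>A bounded set with negligible frontier is Lebesgue measurable but possibly not
      Borel, hence the passage between \<open>lborel\<close> and its completion.\<close>
    have W_meas: "W \<in> lmeasurable" using measurable_Jordan[OF W(1,3)] .
    have borel: "(\<lambda>y. f y * of_real (p y)) \<in> borel_measurable lborel" "f \<in> borel_measurable lborel" "q \<in> borel_measurable lborel"
      using borel_measurable_continuous_onI[OF cont_fp] borel_measurable_continuous_onI[OF f(1)]
        borel_measurable_continuous_onI[OF cont(2)] by simp_all
    have J_leb: "J = (LINT y|lebesgue. f y * of_real (p y))"
      unfolding J_def using borel(1) by (rule integral_completion[symmetric])
    have int_q': "integrable lebesgue q"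
      using int_q borel(3) by (simp add: integrable_completion)
    have int1: "integrable lebesgue (\<lambda>y. indicator W y *\<^sub>R f y)"
    proof (rule Bochner_Integration.integrable_bound)
      show "integrable lebesgue (indicator W :: 'b \<Rightarrow> real)"
        using W_meas by (intro integrable_real_indicator) (auto simp: fmeasurable_def)
      show "(\<lambda>y. indicator W y *\<^sub>R f y) \<in> borel_measurable lebesgue"
        using W_meas measurable_completion[OF borel(2)] by (intro borel_measurable_scaleR borel_measurable_indicator) auto
    qed (use f(2) in \<open>auto simp: indicator_def\<close>)
    have diff_le: "norm (f y * of_real (p y) - indicator W y *\<^sub>R f y) \<le> q y" for y
    proof -
      have "f y * of_real (p y) - indicator W y *\<^sub>R f y = f y * of_real (p y - indicator W y)"
        by (simp add: scaleR_conv_of_real algebra_simps)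
      then have "norm (f y * of_real (p y) - indicator W y *\<^sub>R f y) = norm (f y) * \<bar>indicator W y - p y\<bar>"
        by (simp add: norm_mult abs_minus_commute del: of_real_diff)
      also have "\<dots> \<le> 1 * q y"
        using f(2) pq by (intro mult_mono) auto
      finally show ?thesis by simp
    qed
    have meas1: "(\<lambda>y. f y * of_real (p y)) \<in> borel_measurable lebesgue"
      using borel(1) by (rule measurable_completion)
    have int2: "integrable lebesgue (\<lambda>y. f y * of_real (p y) - indicator W y *\<^sub>R f y)"
      using diff_le meas1 int1
      by (intro Bochner_Integration.integrable_bound[OF int_q'] borel_measurable_diff) (auto intro: order_trans[OF _ abs_ge_self])
    have int3: "integrable lebesgue (\<lambda>y. f y * of_real (p y))"
      using Bochner_Integration.integrable_add[OF int2 int1] by simp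
    have "J - I = (LINT y|lebesgue. f y * of_real (p y) - indicator W y *\<^sub>R f y)"
      unfolding J_leb I_def set_lebesgue_integral_def using int3 int1 by (rule Bochner_Integration.integral_diff[symmetric])
    also have "norm \<dots> \<le> (LINT y|lebesgue. q y)"
      using int2 int_q' diff_le by (intro Bochner_Integration.integral_norm_bound_integral) auto
    also have "\<dots> = (LINT y|lborel. q y)"
      using borel(3) by (rule integral_completion)
    finally show ?thesis .
  qed
  define S where "S r = (\<Sum>l\<in>{l\<in>L. snd l \<in> W \<and> norm (fst l + \<theta> (snd l)) \<le> r}. f (snd l))" for r
  define S0 where "S0 r = (\<Sum>l\<in>points r R. f (snd l) * of_real (p (snd l)))" for r
  define S1 where "S1 r = (\<Sum>l\<in>points r R. q (snd l))" for r
  have S_S0: "norm (S r - S0 r) \<le> S1 r + real (card (shell c R r))" for r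
  proof -
    define A where "A = {l\<in>L. snd l \<in> W \<and> norm (fst l + \<theta> (snd l)) \<le> r}"
    define Q where "Q = points r R \<union> shell c R r"
    have Q: "finite Q" by (simp add: Q_def finite_points finite_shell)
    have near: "\<bar>norm (fst l + \<theta> (snd l)) - norm (fst l)\<bar> \<le> c" if "snd l \<in> W" for l
      using c[OF that] norm_triangle_ineq3[of "fst l + \<theta> (snd l)" "fst l"] by simp
    have AQ: "A \<subseteq> Q"
    proof
      fix l assume "l \<in> A"
      then show "l \<in> Q"
        using near[of l] WR[of "snd l"] by (auto simp: A_def Q_def points_def shell_def)
    qed
    have S: "S r = (\<Sum>l\<in>Q. if l \<in> A then f (snd l) else 0)"
      unfolding S_def A_def[symmetric] using AQ Q by (intro sum.mono_neutral_cong_left) auto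
    have S0: "S0 r = (\<Sum>l\<in>Q. if l \<in> points r R then f (snd l) * of_real (p (snd l)) else 0)"
      unfolding S0_def using Q by (intro sum.mono_neutral_cong_left) (auto simp: Q_def)
    have S1: "S1 r = (\<Sum>l\<in>Q. if l \<in> points r R then q (snd l) else 0)"
      unfolding S1_def using Q by (intro sum.mono_neutral_cong_left) (auto simp: Q_def)
    have shell_sum: "real (card (shell c R r)) = (\<Sum>l\<in>Q. if l \<in> shell c R r then 1 else 0)"
      using Q by (simp add: sum.If_cases Q_def Int_absorb1)
    have q0: "q y \<ge> 0" for y using pq[of y] by linarith
    have le: "norm ((if l \<in> A then f (snd l) else 0) - (if l \<in> points r R then f (snd l) * of_real (p (snd l)) else 0))
       \<le> (if l \<in> points r R then q (snd l) else 0) + (if l \<in> shell c R r then 1 else 0)" if l: "l \<in> Q" for l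
    proof -
      have L: "l \<in> L" "norm (snd l) \<le> R"
        using l by (auto simp: Q_def points_def shell_def)
      have fq: "norm (indicator W (snd l) *\<^sub>R f (snd l) - f (snd l) * of_real (p (snd l))) \<le> q (snd l)"
      proof -
        have "indicator W (snd l) *\<^sub>R f (snd l) - f (snd l) * of_real (p (snd l)) = f (snd l) * of_real (indicator W (snd l) - p (snd l))"
          by (simp add: scaleR_conv_of_real algebra_simps)
        then have "norm (indicator W (snd l) *\<^sub>R f (snd l) - f (snd l) * of_real (p (snd l))) = norm (f (snd l)) * \<bar>indicator W (snd l) - p (snd l)\<bar>"
          by (simp add: norm_mult del: of_real_diff)
        also have "\<dots> \<le> 1 * q (snd l)"
          using f(2) pq by (intro mult_mono) auto
        finally show ?thesis by simp
      qed
      show ?thesis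
      \<comment> \<open>The equivalence can fail only if the displacement carries the point across
        the sphere of radius \<open>r\<close>, and then the point lies in the shell.\<close>
      proof (cases "l \<in> A \<longleftrightarrow> l \<in> points r R \<and> snd l \<in> W")
        case True
        then show ?thesis using fq by (auto split: if_splits)
      next
        case False
        then have W_l: "snd l \<in> W" by (auto simp: A_def)
        have "l \<in> shell c R r"
          using False near[OF W_l] L W_l by (auto simp: A_def points_def shell_def)
        moreover have "norm (f (snd l) * of_real (p (snd l))) \<le> q (snd l) + 1" "norm (f (snd l)) \<le> 1"
        proof -
          show "norm (f (snd l)) \<le> 1" by (rule f)
          then show "norm (f (snd l) * of_real (p (snd l))) \<le> q (snd l) + 1"
            using fq W_l norm_triangle_ineq4[of "f (snd l)" "f (snd l) - f (snd l) * of_real (p (snd l))"] by simp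
        qed
        ultimately show ?thesis using False W_l q0[of "snd l"] by (auto simp del: norm_mult)
      qed
    qed
    have "norm (S r - S0 r) \<le> (\<Sum>l\<in>Q. (if l \<in> points r R then q (snd l) else 0) + (if l \<in> shell c R r then 1 else 0))"
      unfolding S S0 sum_subtractf[symmetric] by (intro order_trans[OF norm_sum] sum_mono le)
    then show ?thesis by (simp only: S1 shell_sum sum.distrib)
  qed
  have lim0: "((\<lambda>r. S0 r / of_real (V r)) \<longlongrightarrow> J / of_real \<delta>) at_top"
    unfolding S0_def J_def \<delta>_def using supp by (intro lattice_sum_tendsto[OF cont_fp]) auto
  have lim1: "((\<lambda>r. S1 r / V r) \<longlongrightarrow> (LINT y|lborel. q y) / \<delta>) at_top"
  proof -
    \<comment> \<open>The equidistribution theorem is stated for complex weights, so the real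
      function \<open>q\<close> is embedded and the limit pulled back.\<close>
    have "((\<lambda>r. (\<Sum>l\<in>points r R. complex_of_real (q (snd l))) / of_real (V r))
        \<longlongrightarrow> (LINT y|lborel. complex_of_real (q y)) / of_real (measure lborel D)) at_top"
      using supp by (intro lattice_sum_tendsto continuous_intros cont) auto
    then have "((\<lambda>r. complex_of_real (S1 r / V r)) \<longlongrightarrow> of_real ((LINT y|lborel. q y) / \<delta>)) at_top"
      by (simp add: S1_def \<delta>_def)
    then show ?thesis by (simp only: tendsto_of_real_iff)
  qed
  have q_frac: "(LINT y|lborel. q y) / \<delta> < e / 5"
    using q_small \<delta> by (simp add: field_simps)
  have "\<forall>\<^sub>F r in at_top. dist (S0 r / of_real (V r)) (J / of_real \<delta>) < e / 5"
    using lim0 by (rule tendstoD) (use e in simp)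
  moreover have "\<forall>\<^sub>F r in at_top. S1 r / V r < e / 5"
    using lim1 q_frac by (rule order_tendstoD)
  moreover have "\<forall>\<^sub>F r in at_top. real (card (shell c R r)) / V r < e / 5"
    by (rule order_tendstoD[OF shell_negligible]) (use e in simp)
  ultimately have "\<forall>\<^sub>F r in at_top. dist (S r / of_real (V r)) (I / of_real \<delta>) < e"
    using eventually_gt_at_top[of 0]
  proof eventually_elim
    case (elim r)
    have V: "V r > 0" using elim(4) by (rule V_pos)
    have "norm (S r / of_real (V r) - S0 r / of_real (V r)) = norm (S r - S0 r) / V r"
      using V by (simp add: norm_divide flip: diff_divide_distrib)
    also have "\<dots> \<le> (S1 r + real (card (shell c R r))) / V r"
      using S_S0[of r] V by (intro divide_right_mono) auto
    finally have 1: "dist (S r / of_real (V r)) (S0 r / of_real (V r)) < e / 5 + e / 5"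
      using add_strict_mono[OF elim(2,3)] by (simp only: dist_norm add_divide_distrib)
    have "dist (J / of_real \<delta>) (I / of_real \<delta>) = norm (J - I) / \<delta>"
      using \<delta> by (simp add: dist_norm norm_divide flip: diff_divide_distrib)
    also have "\<dots> \<le> (LINT y|lborel. q y) / \<delta>"
      using IJ \<delta> by (intro divide_right_mono) auto
    finally have 2: "dist (J / of_real \<delta>) (I / of_real \<delta>) < e / 5"
      using q_frac by (rule le_less_trans)
    show ?case
      using 1 2 elim(1) e dist_triangle[of "S r / of_real (V r)" "I / of_real \<delta>" "S0 r / of_real (V r)"]
        dist_triangle[of "S0 r / of_real (V r)" "I / of_real \<delta>" "J / of_real \<delta>"] by simp
  qed
  then show "\<forall>\<^sub>F r in at_top. dist ((\<Sum>l\<in>{l\<in>L. snd l \<in> W \<and> norm (fst l + \<theta> (snd l)) \<le> r}. f (snd l)) / of_real (V r))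
      ((LINT y:W|lebesgue. f y) / of_real (measure lborel D)) < e"
    by (simp add: S_def I_def \<delta>_def)
qed

end

section \<open>Fourier--Bohr coefficients\<close>

lemma star_map_eq:
  assumes "inj_on fst L" "(x, y) \<in> L"
  shows "star_map L x = y"
  unfolding star_map_def
proof (rule the_equality)
  show "z = y" if "(x, z) \<in> L" for z
    using inj_onD[OF assms(1), of "(x, z)" "(x, y)"] assms(2) that by simp
qed (fact assms(2))

text \<open>Makes the star map of the dual lattice well defined. The difference \<open>a\<close> of
  two internal components pairs integrally with a dense set, hence with every vector since the
  integers are closed; a linear functional with only integer values vanishes.\<close>

lemma inj_on_fst_dual_lattice:
  fixes L :: "((real ^ 'n) \<times> (real ^ 'n)) set"
  assumes dense: "closure (snd ` L) = UNIV"
  shows "inj_on fst (dual_lattice L)"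
proof (rule inj_onI)
  fix z w assume z: "z \<in> dual_lattice L" and w: "w \<in> dual_lattice L" and eq: "fst z = fst w"
  define a where "a = snd z - snd w"
  have "snd ` L \<subseteq> {y. a \<bullet> y \<in> \<int>}"
  proof clarsimp
    fix x y assume "(x, y) \<in> L"
    then have "z \<bullet> (x, y) - w \<bullet> (x, y) \<in> \<int>"
      using z w unfolding dual_lattice_def by (intro Ints_diff) blast+
    then show "a \<bullet> y \<in> \<int>"
      using eq by (simp add: a_def inner_diff_left inner_prod_def)
  qed
  moreover have "closed {y. a \<bullet> y \<in> \<int>}"
    using closed_vimage[OF closed_Ints, of "\<lambda>y. a \<bullet> y"] by (simp add: vimage_def continuous_intros)
  ultimately have all: "a \<bullet> y \<in> \<int>" for y
    using closure_minimal dense by blast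
  have "a = 0"
  proof (rule ccontr)
    assume "a \<noteq> 0"
    \<comment> \<open>This multiple of \<open>a\<close> is scaled to give the non-integer value
      1/2.\<close>
    then have "a \<bullet> ((1 / (2 * (a \<bullet> a))) *\<^sub>R a) = 1 / 2" by simp
    then have "(1 / 2 :: real) \<in> \<int>" using all by metis
    then show False using fraction_not_in_Ints[of 2 1, where ?'a = real] by simp
  qed
  then show "z = w" using eq by (simp add: a_def prod_eq_iff)
qed

text \<open>Duality makes the pairing of \<open>(k, k')\<close> with \<open>(x, y)\<close> an
  integer, which trades the phase in \<open>x\<close> for one in \<open>y\<close>, and the transpose
  moves the deformation onto \<open>k\<close>. The character thus becomes a continuous weight on
  internal space alone.\<close>

lemma cis_character_deformed:
  fixes k k' x y :: "real ^ 'n" and \<theta> :: "real ^ 'n \<Rightarrow> real ^ 'n"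
  assumes "(k, k') \<in> dual_lattice L" "(x, y) \<in> L" "linear \<theta>"
  shows "cis (- (2 * pi * (k \<bullet> (x + \<theta> y)))) = cis (2 * pi * ((k' - transpose (matrix \<theta>) *v k) \<bullet> y))"
proof -
  have "k \<bullet> x + k' \<bullet> y \<in> \<int>"
    using assms(1,2) by (force simp: dual_lattice_def inner_prod_def)
  then obtain m where m: "k \<bullet> x + k' \<bullet> y = of_int m" by (rule Ints_cases)
  have "(transpose (matrix \<theta>) *v k) \<bullet> y = k \<bullet> \<theta> y"
    using fun_cong[OF matrix_vector_mul(2)[OF assms(3)]] by (simp add: dot_lmul_matrix)
  then have "2 * pi * ((k' - transpose (matrix \<theta>) *v k) \<bullet> y) = - (2 * pi * (k \<bullet> (x + \<theta> y))) + 2 * pi * of_int m"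
    unfolding m[symmetric] by (simp add: inner_diff_left inner_add_right algebra_simps)
  then have "cis (2 * pi * ((k' - transpose (matrix \<theta>) *v k) \<bullet> y)) = cis (- (2 * pi * (k \<bullet> (x + \<theta> y)))) * cis (2 * pi * of_int m)"
    by (simp only: cis_mult)
  then show ?thesis by (simp add: cis_multiple_2pi)
qed

text \<open>A deformation may merge points of the model set. The lattice sum counts merged points
  with multiplicity, which is the family version; when no points merge, the sum over the deformed
  set is the same sum.\<close>

theorem theorem3p4:
  fixes L :: "((real ^ 'n) \<times> (real ^ 'n)) set"
    and W :: "(real ^ 'n) set"
    and \<theta> :: "real ^ 'n \<Rightarrow> real ^ 'n"
    and D :: "real ^ 'n ^ 'n"
    and k :: "real ^ 'n"
  assumes "euclidean_cps L"
    and "window W"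
    and "negligible (frontier W)"
    and "linear \<theta>"
    and "D = matrix \<theta>"
    and "k \<in> fourier_module L"
  shows "(inj_on (deformation L \<theta>) (model_set L W) \<longrightarrow>
            has_fourier_bohr_coeff (deformed_model_set L W \<theta>) k
              (amplitude L W (star_map (dual_lattice L) k - transpose D *v k)))
       \<and> has_fourier_bohr_coeff_family (deformation L \<theta>) (model_set L W) k
              (amplitude L W (star_map (dual_lattice L) k - transpose D *v k))"
proof -
  have L: "is_lattice L" "inj_on fst L" "closure (snd ` L) = UNIV"
    using assms(1) by (auto simp: euclidean_cps_def)
  have W: "bounded W" "W \<noteq> {}" "negligible (frontier W)" "interior W \<noteq> {}"
    using assms(2,3) bounded_subset[OF compact_imp_bounded closure_subset]
    by (auto simp: window_def)
  have W_meas: "W \<in> lmeasurable" using measurable_Jordan[OF W(1,3)] .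
  have vol_pos: "measure lebesgue W > 0"
  proof -
    have "\<not> negligible W"
      using W(4) interior_subset negligible_subset open_interior open_not_negligible by metis
    then show ?thesis
      using W_meas by (simp add: negligible_iff_measure zero_less_measure_iff)
  qed
  obtain T where "tiled_lattice L T" using is_lattice_imp_tiled[OF L(1)] .
  then interpret tiled_lattice L T .
  interpret tiled_cps L T "\<lambda>r. measure lborel (cball (0 :: real ^ 'n) r)"
    by unfold_locales (use L in auto)
  have vol_cball: "measure lebesgue (cball (0 :: real ^ 'n) r) = measure lborel (cball (0 :: real ^ 'n) r)" for r
    by (simp add: measure_completion)
  define k' where "k' = star_map (dual_lattice L) k"
  have k': "(k, k') \<in> dual_lattice L"
  proof -
    obtain y where y: "(k, y) \<in> dual_lattice L"
      using assms(6) by (auto simp: fourier_module_def)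
    then show ?thesis
      using star_map_eq[OF inj_on_fst_dual_lattice[OF L(3)] y] by (simp add: k'_def)
  qed
  define \<kappa> where "\<kappa> = k' - transpose D *v k"
  have model: "model_set L W = fst ` {l \<in> L. snd l \<in> W}"
    using star_map_eq[OF L(2)] by (force simp: model_set_def)
  have inj: "inj_on fst {l \<in> L. P l}" for P
    using L(2) by (rule inj_on_subset) auto
  have dens: "dens (model_set L W) = measure lebesgue W / measure lborel T"
  proof -
    \<comment> \<open>The summand \<open>0\<close> is the zero displacement, kept so that the
      general theorem matches.\<close>
    have "((\<lambda>r. (\<Sum>l\<in>{l\<in>L. snd l \<in> W \<and> norm (fst l + 0) \<le> r}. 1 :: complex) / of_real (measure lborel (cball (0 :: real ^ 'n) r)))
        \<longlongrightarrow> (LINT y:W|lebesgue. (1::complex)) / of_real (measure lborel T)) at_top"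
      by (rule weighted_model_set_sum_tendsto[OF W(1-3)]) (auto simp: image_constant_conv)
    moreover have "(LINT y:W|lebesgue. (1::complex)) = of_real (measure lebesgue W)"
      unfolding set_lebesgue_integral_def using W_meas
      by (subst integral_scaleR_left) (auto simp: fmeasurable_def scaleR_conv_of_real)
    moreover have "card (model_set L W \<inter> cball 0 r) = card {l\<in>L. snd l \<in> W \<and> norm (fst l + 0) \<le> r}" for r
    proof -
      have "model_set L W \<inter> cball 0 r = fst ` {l\<in>L. snd l \<in> W \<and> norm (fst l + 0) \<le> r}"
        unfolding model by auto
      then show ?thesis by (simp only: card_image[OF inj])
    qed
    ultimately have "((\<lambda>r. complex_of_real (real (card (model_set L W \<inter> cball 0 r)) / measure lebesgue (cball (0 :: real ^ 'n) r)))
        \<longlongrightarrow> of_real (measure lebesgue W / measure lborel T)) at_top"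
      by (simp add: vol_cball)
    then have "((\<lambda>r. real (card (model_set L W \<inter> cball 0 r)) / measure lebesgue (cball (0 :: real ^ 'n) r))
        \<longlongrightarrow> measure lebesgue W / measure lborel T) at_top"
      by (simp only: tendsto_of_real_iff)
    then show ?thesis
      unfolding dens_def by (rule tendsto_Lim[OF trivial_limit_at_top_linorder])
  qed
  \<comment> \<open>The density divided by the window volume is the reciprocal covolume;
    \<open>vol_pos\<close> justifies the cancellation.\<close>
  have amplitude: "amplitude L W \<kappa> = (LINT y:W|lebesgue. cis (2 * pi * (\<kappa> \<bullet> y))) / of_real (measure lborel T)"
    using vol_pos by (simp add: amplitude_def dens inv_fourier_indicator_def)
  have deform: "deformation L \<theta> (fst l) = fst l + \<theta> (snd l)" if "l \<in> L" for l
    using star_map_eq[OF L(2), of "fst l" "snd l"] that by (simp add: deformation_def)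
  have family: "has_fourier_bohr_coeff_family (deformation L \<theta>) (model_set L W) k (amplitude L W \<kappa>)"
  proof -
    have "(\<Sum>i\<in>{i \<in> model_set L W. norm (deformation L \<theta> i) \<le> r}. cis (- (2 * pi * (k \<bullet> deformation L \<theta> i))))
        = (\<Sum>l\<in>{l\<in>L. snd l \<in> W \<and> norm (fst l + \<theta> (snd l)) \<le> r}. cis (2 * pi * (\<kappa> \<bullet> snd l)))" for r
    proof -
      have "{i \<in> model_set L W. norm (deformation L \<theta> i) \<le> r} = fst ` {l\<in>L. snd l \<in> W \<and> norm (fst l + \<theta> (snd l)) \<le> r}"
        unfolding model using deform by auto
      then show ?thesis
        by (simp only: sum.reindex[OF inj] o_def, intro sum.cong refl)
           (use deform cis_character_deformed[OF k' _ assms(4), of "fst l" "snd l" for l] assms(5) in \<open>auto simp: \<kappa>_def\<close>)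
    qed
    moreover have "((\<lambda>r. (\<Sum>l\<in>{l\<in>L. snd l \<in> W \<and> norm (fst l + \<theta> (snd l)) \<le> r}. cis (2 * pi * (\<kappa> \<bullet> snd l)))
        / of_real (measure lborel (cball (0 :: real ^ 'n) r))) \<longlongrightarrow> amplitude L W \<kappa>) at_top"
      unfolding amplitude
    proof (rule weighted_model_set_sum_tendsto[OF W(1-3)])
      show "bounded (\<theta> ` W)"
        using assms(4) W(1) by (intro bounded_linear_image linear_linear[THEN iffD2])
    qed (auto intro!: continuous_intros)
    ultimately show ?thesis
      by (simp only: has_fourier_bohr_coeff_family_def vol_cball)
  qed
  moreover have "has_fourier_bohr_coeff (deformed_model_set L W \<theta>) k (amplitude L W \<kappa>)"
    if inj_def: "inj_on (deformation L \<theta>) (model_set L W)"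
  proof -
    have "(\<Sum>x\<in>{x \<in> deformed_model_set L W \<theta>. norm x \<le> r}. cis (- (2 * pi * (k \<bullet> x))))
        = (\<Sum>i\<in>{i \<in> model_set L W. norm (deformation L \<theta> i) \<le> r}. cis (- (2 * pi * (k \<bullet> deformation L \<theta> i))))" for r
    proof -
      have "{x \<in> deformed_model_set L W \<theta>. norm x \<le> r} = deformation L \<theta> ` {i \<in> model_set L W. norm (deformation L \<theta> i) \<le> r}"
        unfolding deformed_model_set_def by auto
      moreover have "inj_on (deformation L \<theta>) {i \<in> model_set L W. norm (deformation L \<theta> i) \<le> r}"
        using inj_def by (rule inj_on_subset) auto
      ultimately show ?thesis by (simp add: sum.reindex)
    qed
    then show ?thesis
      using family by (simp only: has_fourier_bohr_coeff_def has_fourier_bohr_coeff_family_def)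
  qed
  ultimately show ?thesis unfolding \<kappa>_def k'_def by blast
qed

end
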